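(* For $j=1,\dots,p$ let $\widetilde{K}_j=\widetilde{Q}_j\widetilde{\Gamma}_j\widetilde{Q}_j^T$ be an eigendecomposition of the $d_j\times d_j$ marginal penalty matrix $\widetilde{K}_j$ (so $\widetilde{Q}_j$ is orthogonal and $\widetilde{\Gamma}_j$ is diagonal), and let $$\Gamma_j=I_{d_1}\otimes\dots\otimes I_{d_{j-1}}\otimes\widetilde{\Gamma}_j\otimes I_{d_{j+1}}\otimes\dots\otimes I_{d_p},\qquad j=1,\dots,p.$$ Let $\gamma_{j,l}$, $l=1,\dots,D$, denote the diagonal entries of the $D\times D$ diagonal matrix $\Gamma_j$, and let $\mathcal{D}^+\subseteq\{1,\dots,D\}$ be the set of indices where at least one $\Gamma_j$ has a positive diagonal entry, i.e. $l\in\mathcal{D}^+$ if and only if there exists $j\in\{1,\dots,p\}$ with $\gamma_{j,l}>0$. Then, for all $\tau^2=(\tau_1^2,\dots,\tau_p^2)\in(0,\infty)^p$, $$\log \mathrm{Det}(K(\tau^2))=\log \mathrm{Det}\left(\frac{\Gamma_1}{\tau_1^2}+\dots+\frac{\Gamma_p}{\tau_p^2}\right)=\sum_{l\in\mathcal{D}^+}\log\left(\frac{\gamma_{1,l}}{\tau_1^2}+\dots+\frac{\gamma_{p,l}}{\tau_p^2}\right).$$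
   Context: Let $p\geq 2$ and let $d_1,\dots,d_p$ be the dimensions of $p$ (cubic) B-spline bases (so $d_j\ge 4$). For each $j$, the marginal penalty matrix is the $d_j\times d_j$ second order differences penalty matrix $\widetilde{K}_j=\Delta_j^T\Delta_j$, where $\Delta_j$ is the $(d_j-2)\times d_j$ second order difference matrix, $(\Delta_j v)_i=v_i-2v_{i+1}+v_{i+2}$. In particular $\widetilde K_j$ is real, symmetric and positive semidefinite. $I_d$ is the $d\times d$ identity matrix and $\otimes$ is the Kronecker product of matrices. For $\tau^2\in(0,\infty)^p$ the overall roughness penalty matrix is the $D\times D$ matrix, $D=\prod_{j=1}^p d_j$, $$K(\tau^2)=\frac{K_1}{\tau_1^2}+\dots+\frac{K_p}{\tau_p^2},\qquad K_j=I_{d_1}\otimes\dots\otimes I_{d_{j-1}}\otimes\widetilde{K}_j\otimes I_{d_{j+1}}\otimes\dots\otimes I_{d_p}.$$ $\mathrm{Det}$ denotes the pseudo-determinant, i.e. the product of the nonzero eigenvalues (counted with multiplicity) of a matrix. *)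

theory Defs
  imports "Jordan_Normal_Form.Char_Poly"
begin

text \<open>
  All indices are 0-based: the factors are numbered by \<open>j < p\<close>, the rows and columns of an
  \<open>n \<times> n\<close> matrix by \<open>i < n\<close>.
\<close>

definition second_diff_mat :: "nat \<Rightarrow> real mat" where
  "second_diff_mat n = mat (n - 2) n
     (\<lambda>(i, k). if k = i then 1 else if k = i + 1 then -2 else if k = i + 2 then 1 else 0)"

lemma second_diff_mat_mult_vec:
  assumes "v \<in> carrier_vec n" and "i < n - 2"
  shows "(second_diff_mat n *\<^sub>v v) $ i = v $ i - 2 * v $ (i + 1) + v $ (i + 2)"
proof -
  have "(second_diff_mat n *\<^sub>v v) $ i =
      (\<Sum>k\<in>{0..<n}. (if k = i then v $ k else 0) + (if k = i + 1 then - 2 * v $ k else 0)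
         + (if k = i + 2 then v $ k else 0))"
    using assms by (auto simp: second_diff_mat_def scalar_prod_def intro!: sum.cong)
  also have "\<dots> = v $ i - 2 * v $ (i + 1) + v $ (i + 2)"
    using assms by (auto simp: sum.distrib)
  finally show ?thesis .
qed

definition marginal_penalty :: "nat \<Rightarrow> real mat" where
  "marginal_penalty n = transpose_mat (second_diff_mat n) * second_diff_mat n"

definition kronecker :: "'a :: times mat \<Rightarrow> 'a mat \<Rightarrow> 'a mat" (infixr \<open>\<otimes>\<^sub>K\<close> 70) where
  "A \<otimes>\<^sub>K B = mat (dim_row A * dim_row B) (dim_col A * dim_col B)
     (\<lambda>(r, s). A $$ (r div dim_row B, s div dim_col B) * B $$ (r mod dim_row B, s mod dim_col B))"

text \<open>
  \<open>kronecker_embed p d M j\<close> is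
  \<open>1\<^sub>m (d 0) \<otimes> \<dots> \<otimes> M \<otimes> \<dots> \<otimes> 1\<^sub>m (d (p - 1))\<close> with \<open>M\<close> as the factor number \<open>j\<close>. The \<open>1 \<times> 1\<close> identity
  on which the fold ends is a neutral element of the Kronecker product.
\<close>

definition kronecker_embed :: "nat \<Rightarrow> (nat \<Rightarrow> nat) \<Rightarrow> real mat \<Rightarrow> nat \<Rightarrow> real mat" where
  "kronecker_embed p d M j =
     foldr (\<otimes>\<^sub>K) (map (\<lambda>i. if i = j then M else 1\<^sub>m (d i)) [0..<p]) (1\<^sub>m 1)"

text \<open>\<open>weighted_sum D p M t\<close> is \<open>M 0 / t 0 + \<dots> + M (p - 1) / t (p - 1)\<close> for \<open>D \<times> D\<close> matrices.\<close>

definition weighted_sum :: "nat \<Rightarrow> nat \<Rightarrow> (nat \<Rightarrow> real mat) \<Rightarrow> (nat \<Rightarrow> real) \<Rightarrow> real mat" where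
  "weighted_sum D p M t = foldr (+) (map (\<lambda>j. (1 / t j) \<cdot>\<^sub>m M j) [0..<p]) (0\<^sub>m D D)"

text \<open>
  The constant \<^const>\<open>orthogonal_mat\<close> of the library does not require the columns to have norm 1,
  so orthogonality is spelled out here.
\<close>

definition eigendecomposition :: "nat \<Rightarrow> real mat \<Rightarrow> real mat \<Rightarrow> real mat \<Rightarrow> bool" where
  "eigendecomposition n A Q G \<longleftrightarrow>
     Q \<in> carrier_mat n n \<and> transpose_mat Q * Q = 1\<^sub>m n \<and> Q * transpose_mat Q = 1\<^sub>m n \<and>
     G \<in> carrier_mat n n \<and> diagonal_mat G \<and>
     A = Q * G * transpose_mat Q"

text \<open>
  Eigenvalues are taken in \<^typ>\<open>real\<close>, which loses nothing for the symmetric matrices considered here.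
  Their multiplicity is the algebraic one, i.e. the order as a root of the characteristic polynomial.
\<close>

definition pseudo_det :: "real mat \<Rightarrow> real" where
  "pseudo_det A = (\<Prod>x\<in>{x. eigenvalue A x \<and> x \<noteq> 0}. x ^ order x (char_poly A))"

end

theory Submission
  imports Defs
begin

text \<open>
  By the mixed-product rule, \<open>Q = Q\<^sub>1 \<otimes> \<dots> \<otimes> Q\<^sub>p\<close> is orthogonal and \<open>K\<^sub>j = Q \<Gamma>\<^sub>j Q\<^sup>T\<close> for every \<open>j\<close>. Hence
  the same \<open>Q\<close> conjugates the two weighted sums into each other, so their characteristic polynomials
  and pseudo-determinants agree. The pseudo-determinant of the diagonal one is the product of its
  nonzero diagonal entries. As the marginal penalties are Gram matrices, all the
  \<open>\<gamma>\<^sub>j\<^sub>,\<^sub>l\<close> are nonnegative, so an entry vanishes only if every \<open>\<gamma>\<^sub>j\<^sub>,\<^sub>l\<close> in it does.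
\<close>

section \<open>Kronecker products of two matrices\<close>

lemma dim_kronecker [simp]:
  "dim_row (A \<otimes>\<^sub>K B) = dim_row A * dim_row B" "dim_col (A \<otimes>\<^sub>K B) = dim_col A * dim_col B"
  by (simp_all add: kronecker_def)

lemma kronecker_carrier:
  "A \<in> carrier_mat m n \<Longrightarrow> B \<in> carrier_mat r s \<Longrightarrow> A \<otimes>\<^sub>K B \<in> carrier_mat (m * r) (n * s)"
  by (auto simp: kronecker_def)

lemma index_kronecker:
  assumes "i < dim_row A * dim_row B" and "k < dim_col A * dim_col B"
  shows "(A \<otimes>\<^sub>K B) $$ (i, k) =
    A $$ (i div dim_row B, k div dim_col B) * B $$ (i mod dim_row B, k mod dim_col B)"
  using assms by (simp add: kronecker_def)

lemma mod_less_of_less_mult: "i < m * n \<Longrightarrow> i mod n < (n :: nat)"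
  by (cases "n = 0") auto

lemma transpose_kronecker: "transpose_mat (A \<otimes>\<^sub>K B) = transpose_mat A \<otimes>\<^sub>K transpose_mat B"
  by (rule eq_matI)
     (auto simp: index_kronecker less_mult_imp_div_less mod_less_of_less_mult)

text \<open>The range below \<open>m * n\<close> splits into \<open>m\<close> blocks of length
  \<open>n\<close>: on block \<open>a\<close> the quotient is constantly \<open>a\<close>, while the
  remainder runs through all values below \<open>n\<close>. Distributivity then separates the double
  sum.\<close>

lemma sum_div_mod_mult:
  fixes f g :: "nat \<Rightarrow> 'a :: semiring_0"
  shows "(\<Sum>k<m * n. f (k div n) * g (k mod n)) = (\<Sum>a<m. f a) * (\<Sum>b<n. g b)"
proof -
  have "(\<Sum>k<m * n. f (k div n) * g (k mod n)) =
      (\<Sum>a<m. \<Sum>k = a * n..<a * n + n. f (k div n) * g (k mod n))"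
    by (rule sum.nat_group [symmetric])
  also have "\<dots> = (\<Sum>a<m. \<Sum>b<n. f a * g b)"
  proof (rule sum.cong)
    fix a
    have "(\<Sum>k = a * n..<a * n + n. f (k div n) * g (k mod n)) =
        (\<Sum>b = 0..<n. f ((b + a * n) div n) * g ((b + a * n) mod n))"
      using sum.shift_bounds_nat_ivl [of "\<lambda>k. f (k div n) * g (k mod n)" 0 "a * n" n]
      by (simp add: add.commute)
    also have "\<dots> = (\<Sum>b<n. f a * g b)"
      by (rule sum.cong) auto
    finally show "(\<Sum>k = a * n..<a * n + n. f (k div n) * g (k mod n)) = (\<Sum>b<n. f a * g b)" .
  qed simp
  finally show ?thesis
    by (simp add: sum_product)
qed

text \<open>The mixed-product rule. The inner summation index encodes a pair of indices as quotient
  and remainder by \<open>dim_row E\<close>; commutativity regroups each summand into a function of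
  the quotient times a function of the remainder, so the sum factorizes.\<close>

lemma kronecker_mult:
  fixes A B C E :: "'a :: comm_semiring_0 mat"
  assumes "dim_col A = dim_row C" and "dim_col B = dim_row E"
  shows "(A \<otimes>\<^sub>K B) * (C \<otimes>\<^sub>K E) = (A * C) \<otimes>\<^sub>K (B * E)"
proof (rule eq_matI)
  fix i k
  assume "i < dim_row ((A * C) \<otimes>\<^sub>K (B * E))" and "k < dim_col ((A * C) \<otimes>\<^sub>K (B * E))"
  then have i: "i < dim_row A * dim_row B" and k: "k < dim_col C * dim_col E"
    by simp_all
  let ?i = "i div dim_row B" and ?i' = "i mod dim_row B"
  let ?k = "k div dim_col E" and ?k' = "k mod dim_col E"
  have b: "?i < dim_row A" "?i' < dim_row B" "?k < dim_col C" "?k' < dim_col E"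
    using i k by (simp_all add: less_mult_imp_div_less mod_less_of_less_mult)
  have "((A \<otimes>\<^sub>K B) * (C \<otimes>\<^sub>K E)) $$ (i, k) =
      (\<Sum>l<dim_row C * dim_row E. (A $$ (?i, l div dim_row E) * C $$ (l div dim_row E, ?k)) *
        (B $$ (?i', l mod dim_row E) * E $$ (l mod dim_row E, ?k')))"
    using i k assms
    by (auto simp: scalar_prod_def index_kronecker lessThan_atLeast0 ac_simps intro!: sum.cong)
  also have "\<dots> = (\<Sum>a<dim_row C. A $$ (?i, a) * C $$ (a, ?k)) *
      (\<Sum>b<dim_row E. B $$ (?i', b) * E $$ (b, ?k'))"
    by (rule sum_div_mod_mult)
  also have "\<dots> = ((A * C) \<otimes>\<^sub>K (B * E)) $$ (i, k)"
    using i k b assms by (simp add: index_kronecker scalar_prod_def lessThan_atLeast0)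
  finally show "((A \<otimes>\<^sub>K B) * (C \<otimes>\<^sub>K E)) $$ (i, k) = ((A * C) \<otimes>\<^sub>K (B * E)) $$ (i, k)" .
qed simp_all

text \<open>An index is determined by its quotient and remainder, so the product of the two
  Kronecker deltas is again a Kronecker delta.\<close>

lemma kronecker_one: "1\<^sub>m m \<otimes>\<^sub>K 1\<^sub>m n = (1\<^sub>m (m * n) :: 'a :: semiring_1 mat)"
proof (rule eq_matI)
  fix i k
  assume "i < dim_row (1\<^sub>m (m * n) :: 'a mat)" and "k < dim_col (1\<^sub>m (m * n) :: 'a mat)"
  then have "i < m * n" and "k < m * n"
    by simp_all
  moreover have "i = k" if "i div n = k div n" and "i mod n = k mod n"
    using that by (metis div_mult_mod_eq)
  ultimately show "(1\<^sub>m m \<otimes>\<^sub>K 1\<^sub>m n) $$ (i, k) = (1\<^sub>m (m * n) :: 'a mat) $$ (i, k)"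
    by (auto simp: index_kronecker less_mult_imp_div_less mod_less_of_less_mult)
qed simp_all

text \<open>Distinct indices differ in quotient or in remainder, so one of the two multiplied
  entries lies off the diagonal.\<close>

lemma diagonal_kronecker:
  fixes A B :: "'a :: mult_zero mat"
  assumes "A \<in> carrier_mat m m" and "B \<in> carrier_mat n n" and "diagonal_mat A" and "diagonal_mat B"
  shows "diagonal_mat (A \<otimes>\<^sub>K B)"
  unfolding diagonal_mat_def
proof (intro allI impI)
  fix i k
  assume "i < dim_row (A \<otimes>\<^sub>K B)" and "k < dim_col (A \<otimes>\<^sub>K B)" and "i \<noteq> k"
  then have ik: "i < m * n" "k < m * n" and "i \<noteq> k"
    using assms by simp_all
  from \<open>i \<noteq> k\<close> have "i div n \<noteq> k div n \<or> i mod n \<noteq> k mod n"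
    by (metis div_mult_mod_eq)
  then show "(A \<otimes>\<^sub>K B) $$ (i, k) = 0"
    using ik assms
    by (auto simp: index_kronecker diagonal_mat_def less_mult_imp_div_less mod_less_of_less_mult)
qed

section \<open>Kronecker products of lists of matrices\<close>

definition kronecker_list :: "('i \<Rightarrow> real mat) \<Rightarrow> 'i list \<Rightarrow> real mat" where
  "kronecker_list F js = foldr (\<otimes>\<^sub>K) (map F js) (1\<^sub>m 1)"

lemma kronecker_list_simps [simp]:
  "kronecker_list F [] = 1\<^sub>m 1"
  "kronecker_list F (j # js) = F j \<otimes>\<^sub>K kronecker_list F js"
  by (simp_all add: kronecker_list_def)

text \<open>Passing to an arbitrary index list makes the embedded matrices accessible to list
  induction.\<close>

lemma kronecker_embed_eq:
  "kronecker_embed p d M j = kronecker_list (\<lambda>i. if i = j then M else 1\<^sub>m (d i)) [0..<p]"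
  by (simp add: kronecker_embed_def kronecker_list_def)

lemma kronecker_list_cong:
  "(\<And>i. i \<in> set js \<Longrightarrow> F i = G i) \<Longrightarrow> kronecker_list F js = kronecker_list G js"
  by (induction js) auto

lemma kronecker_list_carrier:
  "(\<And>i. i \<in> set js \<Longrightarrow> F i \<in> carrier_mat (d i) (d i)) \<Longrightarrow>
    kronecker_list F js \<in> carrier_mat (prod_list (map d js)) (prod_list (map d js))"
  by (induction js) (auto intro!: kronecker_carrier)

lemma transpose_kronecker_list:
  "transpose_mat (kronecker_list F js) = kronecker_list (\<lambda>i. transpose_mat (F i)) js"
  by (induction js) (simp_all add: transpose_kronecker)

lemma kronecker_list_one: "kronecker_list (\<lambda>i. 1\<^sub>m (d i)) js = 1\<^sub>m (prod_list (map d js))"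
  by (induction js) (simp_all add: kronecker_one)

text \<open>Iterates the mixed-product rule. The common square sizes \<open>d i\<close> supply its
  dimension conditions for both the head and the tail.\<close>

lemma kronecker_list_mult:
  assumes "\<And>i. i \<in> set js \<Longrightarrow> F i \<in> carrier_mat (d i) (d i)"
    and "\<And>i. i \<in> set js \<Longrightarrow> G i \<in> carrier_mat (d i) (d i)"
  shows "kronecker_list F js * kronecker_list G js = kronecker_list (\<lambda>i. F i * G i) js"
  using assms
proof (induction js)
  case (Cons j js)
  have "kronecker_list F js \<in> carrier_mat (prod_list (map d js)) (prod_list (map d js))"
    and "kronecker_list G js \<in> carrier_mat (prod_list (map d js)) (prod_list (map d js))"
    using Cons.prems by (auto intro!: kronecker_list_carrier)
  then have "kronecker_list F (j # js) * kronecker_list G (j # js) =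
      (F j * G j) \<otimes>\<^sub>K (kronecker_list F js * kronecker_list G js)"
    using Cons.prems(1) [of j] Cons.prems(2) [of j] by (simp add: kronecker_mult)
  then show ?case
    using Cons by simp
qed simp

lemma diagonal_kronecker_list:
  assumes "\<And>i. i \<in> set js \<Longrightarrow> F i \<in> carrier_mat (d i) (d i)"
    and "\<And>i. i \<in> set js \<Longrightarrow> diagonal_mat (F i)"
  shows "diagonal_mat (kronecker_list F js)"
  using assms
proof (induction js)
  case (Cons j js)
  have "kronecker_list F js \<in> carrier_mat (prod_list (map d js)) (prod_list (map d js))"
    using Cons.prems(1) by (auto intro!: kronecker_list_carrier)
  then show ?case
    using Cons by (auto intro!: diagonal_kronecker)
qed (simp add: diagonal_mat_def)

lemma kronecker_list_nonneg:
  assumes "\<And>j i k. j \<in> set js \<Longrightarrow> i < dim_row (F j) \<Longrightarrow> k < dim_col (F j) \<Longrightarrow> F j $$ (i, k) \<ge> 0"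
    and "i < dim_row (kronecker_list F js)" and "k < dim_col (kronecker_list F js)"
  shows "kronecker_list F js $$ (i, k) \<ge> 0"
  using assms
\<comment> \<open>The indices are generalized because the tail is evaluated at the remainders of
  \<open>i\<close> and \<open>k\<close>.\<close>
proof (induction js arbitrary: i k)
  case (Cons j js)
  then show ?case
    by (auto simp: index_kronecker less_mult_imp_div_less mod_less_of_less_mult
        intro!: mult_nonneg_nonneg)
qed simp

section \<open>Weighted sums of matrices\<close>

lemma weighted_sum_carrier:
  assumes "\<And>j. j < p \<Longrightarrow> M j \<in> carrier_mat D D"
  shows "weighted_sum D p M t \<in> carrier_mat D D"
proof -
  have "foldr (+) (map (\<lambda>j. (1 / t j) \<cdot>\<^sub>m M j) js) (0\<^sub>m D D) \<in> carrier_mat D D"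
    if "set js \<subseteq> {..<p}" for js
    using that assms by (induction js) auto
  from this [of "[0..<p]"] show ?thesis
    by (simp add: weighted_sum_def lessThan_atLeast0)
qed

lemma index_weighted_sum:
  assumes "\<And>j. j < p \<Longrightarrow> M j \<in> carrier_mat D D" and "i < D" and "k < D"
  shows "weighted_sum D p M t $$ (i, k) = (\<Sum>j<p. M j $$ (i, k) / t j)"
proof -
  \<comment> \<open>The dimension is carried through the induction because evaluating an entry of a
    matrix sum requires the indices to be in range.\<close>
  have "foldr (+) (map (\<lambda>j. (1 / t j) \<cdot>\<^sub>m M j) js) (0\<^sub>m D D) \<in> carrier_mat D D \<and>
      foldr (+) (map (\<lambda>j. (1 / t j) \<cdot>\<^sub>m M j) js) (0\<^sub>m D D) $$ (i, k) =
        (\<Sum>j\<leftarrow>js. M j $$ (i, k) / t j)"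
    if "set js \<subseteq> {..<p}" for js
    using that
  proof (induction js)
    case (Cons j js)
    then show ?case
      using assms(1) [of j] assms(2,3) by auto
  qed (use assms in simp)
  from this [of "[0..<p]"] show ?thesis
    by (simp add: weighted_sum_def interv_sum_list_conv_sum_set_nat lessThan_atLeast0)
qed

text \<open>Multiplication by \<open>Q\<close> on the left and \<open>R\<close> on the right is
  linear, so it commutes with forming the weighted sum.\<close>

lemma weighted_sum_conjugate:
  assumes "Q \<in> carrier_mat D D" and "R \<in> carrier_mat D D"
    and "\<And>j. j < p \<Longrightarrow> N j \<in> carrier_mat D D"
    and "\<And>j. j < p \<Longrightarrow> M j = Q * N j * R"
  shows "weighted_sum D p M t = Q * weighted_sum D p N t * R"
proof -
  let ?S = "\<lambda>N js. foldr (+) (map (\<lambda>j. (1 / t j) \<cdot>\<^sub>m N j) js) (0\<^sub>m D D)"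
  have "?S N js \<in> carrier_mat D D \<and> ?S M js = Q * ?S N js * R" if "set js \<subseteq> {..<p}" for js
    using that
  proof (induction js)
    case (Cons j js)
    let ?s = "(1 / t j) \<cdot>\<^sub>m N j"
    have N: "N j \<in> carrier_mat D D" and M: "M j = Q * N j * R" and S: "?S N js \<in> carrier_mat D D"
      and IH: "?S M js = Q * ?S N js * R"
      using Cons assms by auto
    have s: "?s \<in> carrier_mat D D"
      using N by simp
    have "Q * (?s + ?S N js) * R = (Q * ?s + Q * ?S N js) * R"
      using mult_add_distrib_mat [OF assms(1) s S] by simp
    also have "\<dots> = Q * ?s * R + Q * ?S N js * R"
      using assms(1,2) s S by (intro add_mult_distrib_mat) auto
    also have "Q * ?s * R = (1 / t j) \<cdot>\<^sub>m M j"
      unfolding M using assms(1,2) N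
      by (metis mult_carrier_mat mult_smult_assoc_mat mult_smult_distrib)
    finally show ?case
      using S s IH by simp
  qed (use assms in simp)
  from this [of "[0..<p]"] show ?thesis
    by (simp add: weighted_sum_def lessThan_atLeast0)
qed

section \<open>Pseudo-determinants\<close>

lemma pseudo_det_similar:
  assumes "similar_mat A B"
  shows "pseudo_det A = pseudo_det B"
proof -
  obtain n where "A \<in> carrier_mat n n" and "B \<in> carrier_mat n n"
    using similar_matD [OF assms] by auto
  \<comment> \<open>Eigenvalues and their multiplicities are both read off from the characteristic
    polynomial, which similar matrices share.\<close>
  then show ?thesis
    by (simp add: pseudo_det_def eigenvalue_root_char_poly char_poly_similar [OF assms])
qed

text \<open>The order at \<open>x\<close> is additive over nonzero products, and a linear factor
  contributes 1 exactly when its root is \<open>x\<close>.\<close>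

lemma order_prod_linear:
  fixes f :: "'i \<Rightarrow> 'a :: idom"
  assumes "finite S"
  shows "order x (\<Prod>l\<in>S. [:- f l, 1:]) = card {l \<in> S. f l = x}"
  using assms
proof (induction S)
  case (insert l S)
  have "order x [:- f l, 1:] = (if f l = x then 1 else 0)"
    using order_power_n_n [of x 1] by (auto simp: order_root intro!: order_0I)
  moreover have "{k \<in> insert l S. f k = x} =
      (if f l = x then insert l {k \<in> S. f k = x} else {k \<in> S. f k = x})"
    by auto
  moreover have "[:- f l, 1:] * (\<Prod>l\<in>S. [:- f l, 1:]) \<noteq> 0"
    using insert.hyps by (simp del: mult_pCons_left)
  ultimately show ?case
    using insert by (auto simp: order_mult simp del: mult_pCons_left)
qed simp

text \<open>The pseudo-determinant runs over distinct eigenvalues with exponents; grouping the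
  diagonal positions by the value of their entry turns this into a product over positions.\<close>

lemma pseudo_det_diagonal:
  assumes A: "A \<in> carrier_mat n n" and "diagonal_mat A"
  shows "pseudo_det A = (\<Prod>l\<in>{l. l < n \<and> A $$ (l, l) \<noteq> 0}. A $$ (l, l))"
proof -
  define f where "f = (\<lambda>l. A $$ (l, l))"
  let ?S = "{l. l < n \<and> f l \<noteq> 0}"
  have "upper_triangular A"
    using assms by (auto simp: upper_triangular_def diagonal_mat_def)
  then have "char_poly A = (\<Prod>a\<leftarrow>diag_mat A. [:- a, 1:])"
    using char_poly_upper_triangular [OF A] by simp
  also have "\<dots> = (\<Prod>l<n. [:- f l, 1:])"
    using A prod.distinct_set_conv_list [of "[0..<n]" "\<lambda>l. [:- f l, 1:]"]
    by (simp add: diag_mat_def f_def lessThan_atLeast0 comp_def)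
  finally have cp: "char_poly A = (\<Prod>l<n. [:- f l, 1:])" .
  have ev: "{x. eigenvalue A x \<and> x \<noteq> 0} = f ` ?S"
    unfolding eigenvalue_root_char_poly [OF A] cp by (auto simp: poly_prod)
  have "x ^ order x (char_poly A) = (\<Prod>l\<in>{l \<in> ?S. f l = x}. f l)" if "x \<in> f ` ?S" for x
  proof -
    \<comment> \<open>Since \<open>x\<close> is nonzero, every position with entry \<open>x\<close>
      lies in \<open>?S\<close>; hence the multiplicity of \<open>x\<close> is the size of its
      fibre.\<close>
    have "{l \<in> ?S. f l = x} = {l \<in> {..<n}. f l = x}"
      using that by auto
    then show ?thesis
      by (simp add: cp order_prod_linear)
  qed
  then have "pseudo_det A = (\<Prod>x\<in>f ` ?S. \<Prod>l\<in>{l \<in> ?S. f l = x}. f l)"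
    by (simp add: pseudo_det_def ev)
  also have "\<dots> = (\<Prod>l\<in>?S. f l)"
    by (rule prod.image_gen [symmetric]) simp
  finally show ?thesis
    by (simp add: f_def)
qed

text \<open>Solving for \<open>G\<close> shows that it is the Gram matrix of \<open>B * Q\<close>,
  so its diagonal entries are squared norms of columns. The off-diagonal ones vanish; they are
  included to match the entrywise premise of \<open>kronecker_list_nonneg\<close>.\<close>

lemma eigendecomposition_gram_nonneg:
  assumes ed: "eigendecomposition n (transpose_mat B * B) Q G" and B: "B \<in> carrier_mat m n"
    and "i < n" and "k < n"
  shows "G $$ (i, k) \<ge> 0"
proof -
  have Q: "Q \<in> carrier_mat n n" and G: "G \<in> carrier_mat n n" and QQ: "transpose_mat Q * Q = 1\<^sub>m n"
    and diag: "diagonal_mat G" and eq: "transpose_mat B * B = Q * G * transpose_mat Q"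
    using ed by (auto simp: eigendecomposition_def)
  let ?C = "B * Q"
  have C: "?C \<in> carrier_mat m n"
    using B Q by simp
  have "transpose_mat ?C * ?C = transpose_mat Q * (transpose_mat B * B) * Q"
    using B Q by (simp add: transpose_mult assoc_mult_mat [of _ n m _ n _ n]
        assoc_mult_mat [of _ n n _ m _ n] assoc_mult_mat [of _ n n _ n _ n])
  also have "\<dots> = (transpose_mat Q * Q) * G * (transpose_mat Q * Q)"
    unfolding eq using Q G by (simp add: assoc_mult_mat [of _ n n _ n _ n])
  also have "\<dots> = G"
    using G by (simp add: QQ)
  finally have "G $$ (i, i) = col ?C i \<bullet> col ?C i"
    using C \<open>i < n\<close> by (metis carrier_matD index_mult_mat(1) index_transpose_mat(2) row_transpose)
  also have "\<dots> \<ge> 0"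
    by (auto simp: scalar_prod_def intro!: sum_nonneg)
  finally show ?thesis
    using diag G \<open>i < n\<close> \<open>k < n\<close> by (cases "i = k") (auto simp: diagonal_mat_def)
qed

lemma second_diff_mat_carrier: "second_diff_mat n \<in> carrier_mat (n - 2) n"
  by (simp add: second_diff_mat_def)

theorem corollary3p2:
  fixes p D :: nat
    and d :: "nat \<Rightarrow> nat"
    and Qt Gammat K Gamma :: "nat \<Rightarrow> real mat"
    and gamma :: "nat \<Rightarrow> nat \<Rightarrow> real"
    and Dplus :: "nat set"
    and tau2 :: "nat \<Rightarrow> real"
  assumes "p \<ge> 2"
    and "\<And>j. j < p \<Longrightarrow> d j \<ge> 4"
    and "\<And>j. j < p \<Longrightarrow> eigendecomposition (d j) (marginal_penalty (d j)) (Qt j) (Gammat j)"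
    and "\<And>j. j < p \<Longrightarrow> tau2 j > 0"
  defines "D \<equiv> \<Prod>j<p. d j"
    and "K \<equiv> \<lambda>j. kronecker_embed p d (marginal_penalty (d j)) j"
    and "Gamma \<equiv> \<lambda>j. kronecker_embed p d (Gammat j) j"
    and "gamma \<equiv> \<lambda>j l. Gamma j $$ (l, l)"
    and "Dplus \<equiv> {l. l < D \<and> (\<exists>j<p. gamma j l > 0)}"
  shows "ln (pseudo_det (weighted_sum D p K tau2)) = ln (pseudo_det (weighted_sum D p Gamma tau2)) \<and>
    ln (pseudo_det (weighted_sum D p Gamma tau2)) = (\<Sum>l\<in>Dplus. ln (\<Sum>j<p. gamma j l / tau2 j))"
proof -
  have ed: "eigendecomposition (d j) (marginal_penalty (d j)) (Qt j) (Gammat j)" if "j < p" for j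
    using assms(3) that .
  have Qt: "Qt j \<in> carrier_mat (d j) (d j)" and Gt: "Gammat j \<in> carrier_mat (d j) (d j)"
    and QtQ: "transpose_mat (Qt j) * Qt j = 1\<^sub>m (d j)"
    and QQt: "Qt j * transpose_mat (Qt j) = 1\<^sub>m (d j)" and diag: "diagonal_mat (Gammat j)"
    and eq: "marginal_penalty (d j) = Qt j * Gammat j * transpose_mat (Qt j)" if "j < p" for j
    using ed [OF that] by (auto simp: eigendecomposition_def)

  \<comment> \<open>Simultaneous diagonalization of the penalties\<close>
  have D: "prod_list (map d [0..<p]) = D"
    using prod.distinct_set_conv_list [of "[0..<p]" d] by (simp add: D_def lessThan_atLeast0)
  define Q where "Q = kronecker_list Qt [0..<p]"
  have Q: "Q \<in> carrier_mat D D"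
    unfolding Q_def D [symmetric] using Qt by (intro kronecker_list_carrier) auto
  have QT: "transpose_mat Q = kronecker_list (\<lambda>i. transpose_mat (Qt i)) [0..<p]"
    by (simp add: Q_def transpose_kronecker_list)
  have "Q * transpose_mat Q = kronecker_list (\<lambda>i. Qt i * transpose_mat (Qt i)) [0..<p]"
    unfolding QT unfolding Q_def using Qt by (intro kronecker_list_mult [where d = d]) auto
  also have "\<dots> = kronecker_list (\<lambda>i. 1\<^sub>m (d i)) [0..<p]"
    using QQt by (intro kronecker_list_cong) auto
  finally have Q1: "Q * transpose_mat Q = 1\<^sub>m D"
    by (simp only: kronecker_list_one D)
  have "transpose_mat Q * Q = kronecker_list (\<lambda>i. transpose_mat (Qt i) * Qt i) [0..<p]"
    unfolding QT unfolding Q_def using Qt by (intro kronecker_list_mult [where d = d]) auto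
  also have "\<dots> = kronecker_list (\<lambda>i. 1\<^sub>m (d i)) [0..<p]"
    using QtQ by (intro kronecker_list_cong) auto
  finally have Q2: "transpose_mat Q * Q = 1\<^sub>m D"
    by (simp only: kronecker_list_one D)
  let ?F = "\<lambda>j i. if i = j then Gammat j else 1\<^sub>m (d i)"
  have F: "?F j i \<in> carrier_mat (d i) (d i)" if "i < p" for i j
    using Gt that by auto
  \<comment> \<open>This covers every \<open>j\<close>: from \<open>p\<close> on, no factor is
    replaced and the product is the identity.\<close>
  have Gamma: "Gamma j \<in> carrier_mat D D" for j
    unfolding Gamma_def kronecker_embed_eq D [symmetric] using F by (intro kronecker_list_carrier) auto
  have "diagonal_mat (?F j i)" if "i < p" for i j
    using diag [OF that] by (auto simp: diagonal_mat_def)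
  then have Gamma_diag: "diagonal_mat (Gamma j)" for j
    unfolding Gamma_def kronecker_embed_eq using F
    by (intro diagonal_kronecker_list [where d = d]) auto
  have K: "K j = Q * Gamma j * transpose_mat Q" if "j < p" for j
  proof -
    have "Q * Gamma j * transpose_mat Q =
        kronecker_list (\<lambda>i. Qt i * ?F j i) [0..<p] * transpose_mat Q"
      unfolding Q_def Gamma_def kronecker_embed_eq
      using Qt Gt by (subst kronecker_list_mult [where d = d]) auto
    also have "\<dots> = kronecker_list (\<lambda>i. Qt i * ?F j i * transpose_mat (Qt i)) [0..<p]"
      unfolding QT using Qt Gt by (intro kronecker_list_mult [where d = d] mult_carrier_mat) auto
    also have "\<dots> = K j"
      unfolding K_def kronecker_embed_eq
    \<comment> \<open>Factor \<open>j\<close> is the eigendecomposition of the marginal penalty; any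
      other factor collapses to \<open>Qt i * transpose_mat (Qt i)\<close>, the identity.\<close>
    proof (rule kronecker_list_cong)
      fix i
      assume "i \<in> set [0..<p]"
      then show "Qt i * ?F j i * transpose_mat (Qt i) =
          (if i = j then marginal_penalty (d j) else 1\<^sub>m (d i))"
        using Qt [of i] QQt [of i] eq [of i] by auto
    qed
    finally show ?thesis ..
  qed

  \<comment> \<open>Similarity of the two weighted sums\<close>
  let ?W = "weighted_sum D p Gamma tau2"
  have W: "?W \<in> carrier_mat D D"
    using Gamma by (rule weighted_sum_carrier)
  have Kc: "K j \<in> carrier_mat D D" if "j < p" for j
    using K [OF that] Gamma [of j] Q by auto
  have "similar_mat (weighted_sum D p K tau2) ?W"
  proof (rule similar_matI)
    show "weighted_sum D p K tau2 = Q * ?W * transpose_mat Q"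
      using Q Gamma K by (intro weighted_sum_conjugate) auto
    show "{weighted_sum D p K tau2, ?W, Q, transpose_mat Q} \<subseteq> carrier_mat D D"
      using W Q weighted_sum_carrier [of p K D tau2] Kc by auto
  qed (fact Q1 Q2)+
  then have "pseudo_det (weighted_sum D p K tau2) = pseudo_det ?W"
    by (rule pseudo_det_similar)

  \<comment> \<open>Logarithm of the diagonal pseudo-determinant\<close>
  moreover have "ln (pseudo_det ?W) = (\<Sum>l\<in>Dplus. ln (\<Sum>j<p. gamma j l / tau2 j))"
  proof -
    have W_diag: "?W $$ (l, l) = (\<Sum>j<p. gamma j l / tau2 j)" if "l < D" for l
      unfolding gamma_def using Gamma that by (intro index_weighted_sum) auto
    have "Gamma j $$ (i, k) = 0" if "i < D" and "k < D" and "i \<noteq> k" for i j k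
      using Gamma [of j] Gamma_diag [of j] that by (auto simp: diagonal_mat_def)
    then have "diagonal_mat ?W"
      using W Gamma unfolding diagonal_mat_def by (auto simp: index_weighted_sum intro!: sum.neutral)
    have nonneg: "gamma j l \<ge> 0" if "j < p" and "l < D" for j l
    proof -
      \<comment> \<open>The marginal penalty is the Gram matrix of the second difference matrix; the
        remaining Kronecker factors are identities.\<close>
      have "Gammat j $$ (i, k) \<ge> 0" if "i < d j" and "k < d j" for i k
        using ed [OF \<open>j < p\<close>] second_diff_mat_carrier that
        unfolding marginal_penalty_def by (rule eigendecomposition_gram_nonneg)
      then show ?thesis
        using that Gamma [of j] Gt [of j] unfolding gamma_def Gamma_def kronecker_embed_eq
        by (intro kronecker_list_nonneg) auto
    qed
    \<comment> \<open>Nonnegativity rules out cancellation, and division by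
      \<open>tau2 j > 0\<close> preserves the sign of \<open>gamma j l\<close>.\<close>
    have "(\<Sum>j<p. gamma j l / tau2 j) \<noteq> 0 \<longleftrightarrow> (\<exists>j<p. gamma j l > 0)" if "l < D" for l
    proof -
      have "gamma j l / tau2 j \<ge> 0" if "j < p" for j
        using nonneg [of j l] assms(4) [of j] \<open>l < D\<close> that by simp
      then have "(\<Sum>j<p. gamma j l / tau2 j) \<noteq> 0 \<longleftrightarrow> (\<exists>j<p. gamma j l / tau2 j \<noteq> 0)"
        by (subst sum_nonneg_eq_0_iff) auto
      moreover have "gamma j l / tau2 j \<noteq> 0 \<longleftrightarrow> gamma j l > 0" if "j < p" for j
        using nonneg [of j l] assms(4) [of j] \<open>l < D\<close> that by auto
      ultimately show ?thesis
        by blast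
    qed
    then have "{l. l < D \<and> ?W $$ (l, l) \<noteq> 0} = Dplus"
      using W_diag unfolding Dplus_def by (intro Collect_cong conj_cong) simp_all
    \<comment> \<open>\<open>Dplus\<close> is finite and no factor over it vanishes, so the
      logarithm of the product splits into a sum.\<close>
    then have "pseudo_det ?W = (\<Prod>l\<in>Dplus. ?W $$ (l, l))"
      and "\<forall>l\<in>Dplus. l < D \<and> ?W $$ (l, l) \<noteq> 0" and "finite Dplus"
      using pseudo_det_diagonal [OF W \<open>diagonal_mat ?W\<close>] by auto
    then show ?thesis
      using W_diag by (subst ln_prod [symmetric]) auto
  qed
  ultimately show ?thesis
    by simp
qed

end
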